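(* Let $q\in(0,1)$, $\omega\ge0$, let $I$ be a real interval containing $\omega_0=\frac{\omega}{1-q}$, let $a,b\in I$ with $a<b$, and let $\alpha,\beta\in\mathbb R$. Let $L,\bar L:I\times\mathbb R\times\mathbb R\to\mathbb R$ both satisfy the hypotheses (i)–(iii) listed in the context, and put $$\mathcal L[y]=\int_a^bL\left(t,y^\sigma(t),\tilde D_{q,\omega}[y](t)\right)\tilde d_{q,\omega}t,\qquad\bar{\mathcal L}[\bar y]=\int_a^b\bar L\left(t,\bar y^\sigma(t),\tilde D_{q,\omega}[\bar y](t)\right)\tilde d_{q,\omega}t.$$ Let $y=z(t,\bar y)$ be a transformation having a unique inverse $\bar y=\bar z(t,y)$ for all $t\in[a,b]_{q,\omega}$, such that there is a one-to-one correspondence $y(t)\leftrightarrow\bar y(t)$ between all functions $y\in\mathcal Y^1([a,b]_{q,\omega},\mathbb R)$ satisfying the boundary conditions $y(a)=\alpha$, $y(b)=\beta$ and all functions $\bar y\in\mathcal Y^1([a,b]_{q,\omega},\mathbb R)$ satisfying $$\bar y(a)=\bar z(a,\alpha)\quad\text{and}\quad\bar y(b)=\bar z(b,\beta).\qquad( * )$$ Suppose that the transformation $y=z(t,\bar y)$ is such that there exists a function $G:I\times\mathbb R\to\mathbb R$ satisfying the identity $$L\left(t,y^\sigma(t),\tilde D_{q,\omega}[y](t)\right)-\bar L\left(t,\bar y^\sigma(t),\tilde D_{q,\omega}[\bar y](t)\right)=\tilde D_{q,\omega}\left[\tau\mapsto G(\tau,\bar y(\tau))\right](t)$$ for all $t\in[a,b]_{q,\omega}$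 (for all corresponding pairs $y,\bar y$). If $\bar y_*$ is a maximizer (resp. a minimizer) of $\bar{\mathcal L}$ with $\bar y_*$ satisfying $( * )$, then $y_*=z(t,\bar y_* )$ is a maximizer (resp. a minimizer) of $\mathcal L$ for $y_*$ satisfying $y_*(a)=\alpha$ and $y_*(b)=\beta$.
   Context: Notation: $\sigma(t)=qt+\omega$, $\sigma^{-1}(t)=q^{-1}(t-\omega)$, $\sigma^k$ the $k$-fold composition, $f^\sigma=f\circ\sigma$. Hahn symmetric derivative: for $f:I\to\mathbb R$ and $t\in(qI+\omega)\setminus\{\omega_0\}$, $\tilde D_{q,\omega}[f](t)=\frac{f(qt+\omega)-f(q^{-1}(t-\omega))}{(q-q^{-1})t+(1+q^{-1})\omega}$, and $\tilde D_{q,\omega}[f](\omega_0)=f'(\omega_0)$ provided $f$ is differentiable at $\omega_0$. Integral: $\int_a^bf\,\tilde d_{q,\omega}t=\int_{\omega_0}^bf\,\tilde d_{q,\omega}t-\int_{\omega_0}^af\,\tilde d_{q,\omega}t$, where $\int_{\omega_0}^xf(t)\,\tilde d_{q,\omega}t=(\sigma^{-1}(x)-\sigma(x))\sum_{n=0}^{\infty}q^{2n+1}f(\sigma^{2n+1}(x))$, provided the series converge. Set: $[a,b]_{q,\omega}=\{\sigma^{2n+1}(a):n\in\mathbb N_0\}\cup\{\sigma^{2n+1}(b):n\in\mathbb N_0\}\cup\{\omega_0\}$. Space: $\mathcal Y^1([a,b]_{q,\omega},\mathbb R)$ is the set of $y:I\to\mathbb R$ such that $y$ and $\tilde D_{q,\omega}[y]$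 are bounded on $[a,b]_{q,\omega}$ and continuous at $\omega_0$. Hypotheses on a Lagrangian $\Lambda\in\{L,\bar L\}$: (i) $(u,v)\mapsto\Lambda(t,u,v)$ is $C^1(\mathbb R^2,\mathbb R)$ for every $t\in I$; (ii) $t\mapsto\Lambda(t,y^\sigma(t),\tilde D_{q,\omega}[y](t))$ is continuous at $\omega_0$ for every admissible $y$; (iii) $t\mapsto\partial_{i+2}\Lambda(t,y^\sigma(t),\tilde D_{q,\omega}[y](t))$ belongs to $\mathcal Y^1([a,b]_{q,\omega},\mathbb R)$ for every admissible $y$, $i=0,1$ ($\partial_j$ is the partial derivative in the $j$th argument). Admissible means in $\mathcal Y^1([a,b]_{q,\omega},\mathbb R)$ and satisfying the boundary conditions of the respective problem: $y(a)=\alpha,\ y(b)=\beta$ for $L$, and $( * )$ for $\bar L$. Maximizers and minimizers are over the respective admissible functions. *)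

theory Defs
  imports "HOL-Analysis.Analysis" "HOL-Library.FuncSet"
begin

definition hahn_shift :: "real \<Rightarrow> real \<Rightarrow> real \<Rightarrow> real" where
  "hahn_shift q \<omega> t = q * t + \<omega>"

definition hahn_unshift :: "real \<Rightarrow> real \<Rightarrow> real \<Rightarrow> real" where
  "hahn_unshift q \<omega> t = inverse q * (t - \<omega>)"

text \<open>The fixed point \<open>\<omega>\<^sub>0\<close> of the shift.\<close>

definition hahn_fix :: "real \<Rightarrow> real \<Rightarrow> real" where
  "hahn_fix q \<omega> = \<omega> / (1 - q)"

text \<open>
  The derivative is meaningful for \<open>t\<close> in the image of \<open>I\<close> under the shift, which
  contains \<open>\<omega>\<^sub>0\<close>. At \<open>\<omega>\<^sub>0\<close> it is the ordinary derivative relative to \<open>I\<close> (one-sided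
  if \<open>\<omega>\<^sub>0\<close> is an end point of \<open>I\<close>). The term is total, so differentiability at \<open>\<omega>\<^sub>0\<close>
  has to be required separately wherever the value at \<open>\<omega>\<^sub>0\<close> is used.
\<close>

definition hahn_deriv ::
  "real \<Rightarrow> real \<Rightarrow> real set \<Rightarrow> (real \<Rightarrow> real) \<Rightarrow> real \<Rightarrow> real" where
  "hahn_deriv q \<omega> I f t =
     (if t = hahn_fix q \<omega> then vector_derivative f (at (hahn_fix q \<omega>) within I)
      else (f (hahn_shift q \<omega> t) - f (hahn_unshift q \<omega> t)) /
           ((q - inverse q) * t + (1 + inverse q) * \<omega>))"

definition hahn_integral0 ::
  "real \<Rightarrow> real \<Rightarrow> real \<Rightarrow> (real \<Rightarrow> real) \<Rightarrow> real" where
  "hahn_integral0 q \<omega> x f =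
     (hahn_unshift q \<omega> x - hahn_shift q \<omega> x) *
     (\<Sum>n. q ^ (2 * n + 1) * f ((hahn_shift q \<omega> ^^ (2 * n + 1)) x))"

definition hahn_integral ::
  "real \<Rightarrow> real \<Rightarrow> real \<Rightarrow> real \<Rightarrow> (real \<Rightarrow> real) \<Rightarrow> real" where
  "hahn_integral q \<omega> a b f = hahn_integral0 q \<omega> b f - hahn_integral0 q \<omega> a f"

definition hahn_points :: "real \<Rightarrow> real \<Rightarrow> real \<Rightarrow> real \<Rightarrow> real set" where
  "hahn_points q \<omega> a b =
     {(hahn_shift q \<omega> ^^ (2 * n + 1)) a | n. True} \<union>
     {(hahn_shift q \<omega> ^^ (2 * n + 1)) b | n. True} \<union> {hahn_fix q \<omega>}"

text \<open>
  Functions \<open>I \<rightarrow> \<real>\<close> are represented by extensional functions, so that equality of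
  members of the following space is equality on \<open>I\<close>. Continuity at \<open>\<omega>\<^sub>0\<close> is relative
  to the domain of the function concerned: \<open>I\<close> for \<open>y\<close>, and the image of \<open>I\<close> under
  the shift for its Hahn derivative.
\<close>

definition hahn_Y1 ::
  "real \<Rightarrow> real \<Rightarrow> real set \<Rightarrow> real \<Rightarrow> real \<Rightarrow> (real \<Rightarrow> real) set" where
  "hahn_Y1 q \<omega> I a b =
     {y \<in> I \<rightarrow>\<^sub>E UNIV.
        bounded (y ` hahn_points q \<omega> a b) \<and>
        continuous (at (hahn_fix q \<omega>) within I) y \<and>
        y differentiable (at (hahn_fix q \<omega>) within I) \<and>
        bounded (hahn_deriv q \<omega> I y ` hahn_points q \<omega> a b) \<and>
        continuous (at (hahn_fix q \<omega>) within (hahn_shift q \<omega> ` I)) (hahn_deriv q \<omega> I y)}"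

definition hahn_admissible ::
  "real \<Rightarrow> real \<Rightarrow> real set \<Rightarrow> real \<Rightarrow> real \<Rightarrow> real \<Rightarrow> real \<Rightarrow> (real \<Rightarrow> real) set" where
  "hahn_admissible q \<omega> I a b \<alpha> \<beta> = {y \<in> hahn_Y1 q \<omega> I a b. y a = \<alpha> \<and> y b = \<beta>}"

text \<open>
  Composition \<open>t \<mapsto> F(t, y\<^sup>\<sigma>(t), D[y](t))\<close>, used both for a Lagrangian and for its
  partial derivatives.
\<close>

definition hahn_along ::
  "real \<Rightarrow> real \<Rightarrow> real set \<Rightarrow> (real \<Rightarrow> real \<Rightarrow> real \<Rightarrow> real) \<Rightarrow> (real \<Rightarrow> real) \<Rightarrow> real \<Rightarrow> real" where
  "hahn_along q \<omega> I F y t = F t (y (hahn_shift q \<omega> t)) (hahn_deriv q \<omega> I y t)"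

definition hahn_functional ::
  "real \<Rightarrow> real \<Rightarrow> real set \<Rightarrow> real \<Rightarrow> real \<Rightarrow>
   (real \<Rightarrow> real \<Rightarrow> real \<Rightarrow> real) \<Rightarrow> (real \<Rightarrow> real) \<Rightarrow> real" where
  "hahn_functional q \<omega> I a b L y = hahn_integral q \<omega> a b (hahn_along q \<omega> I L y)"

definition C1_plane :: "(real \<times> real \<Rightarrow> real) \<Rightarrow> bool" where
  "C1_plane f \<longleftrightarrow>
     (\<exists>f' :: real \<times> real \<Rightarrow> (real \<times> real) \<Rightarrow>\<^sub>L real.
        (\<forall>p. (f has_derivative blinfun_apply (f' p)) (at p)) \<and> continuous_on UNIV f')"

definition partial2 ::
  "(real \<Rightarrow> real \<Rightarrow> real \<Rightarrow> real) \<Rightarrow> real \<Rightarrow> real \<Rightarrow> real \<Rightarrow> real" where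
  "partial2 L t u v = deriv (\<lambda>x. L t x v) u"

definition partial3 ::
  "(real \<Rightarrow> real \<Rightarrow> real \<Rightarrow> real) \<Rightarrow> real \<Rightarrow> real \<Rightarrow> real \<Rightarrow> real" where
  "partial3 L t u v = deriv (\<lambda>x. L t u x) v"

text \<open>
  In the last two conditions the composed function has a prescribed value only on the
  image of \<open>I\<close> under the shift. Its values elsewhere in \<open>I\<close> cannot influence membership
  in \<open>hahn_Y1\<close>: that image is a neighbourhood of \<open>\<omega>\<^sub>0\<close> in \<open>I\<close>, and on \<open>hahn_points\<close>
  they enter the Hahn derivative only at the images of \<open>a\<close> and \<open>b\<close>, which is irrelevant
  for boundedness.

  The second condition makes the series defining \<open>hahn_functional\<close> converge for every
  admissible function.
\<close>

definition hahn_lagrangian ::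
  "real \<Rightarrow> real \<Rightarrow> real set \<Rightarrow> real \<Rightarrow> real \<Rightarrow> real \<Rightarrow> real \<Rightarrow>
   (real \<Rightarrow> real \<Rightarrow> real \<Rightarrow> real) \<Rightarrow> bool" where
  "hahn_lagrangian q \<omega> I a b \<alpha> \<beta> L \<longleftrightarrow>
     (\<forall>t\<in>I. C1_plane (\<lambda>(u, v). L t u v)) \<and>
     (\<forall>y\<in>hahn_admissible q \<omega> I a b \<alpha> \<beta>.
        continuous (at (hahn_fix q \<omega>) within (hahn_shift q \<omega> ` I)) (hahn_along q \<omega> I L y)) \<and>
     (\<forall>y\<in>hahn_admissible q \<omega> I a b \<alpha> \<beta>.
        restrict (hahn_along q \<omega> I (partial2 L) y) I \<in> hahn_Y1 q \<omega> I a b \<and>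
        restrict (hahn_along q \<omega> I (partial3 L) y) I \<in> hahn_Y1 q \<omega> I a b)"

text \<open>The action \<open>y(t) = z(t, v(t))\<close>, \<open>t \<in> I\<close>, of a pointwise transformation on functions.\<close>

definition hahn_transform ::
  "real set \<Rightarrow> (real \<Rightarrow> real \<Rightarrow> real) \<Rightarrow> (real \<Rightarrow> real) \<Rightarrow> real \<Rightarrow> real" where
  "hahn_transform I z v = (\<lambda>t\<in>I. z t (v t))"

end

theory Submission
  imports Defs
begin

text \<open>
  The Hahn integral of a Hahn derivative telescopes, so along corresponding functions the two
  functionals differ by \<open>G(b, ybar(b)) - G(a, ybar(a))\<close>. By the boundary conditions this is the
  same constant for all admissible \<open>ybar\<close>, and therefore the correspondence preserves maximizers
  and minimizers.
\<close>

lemma hahn_fix_mult: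
  assumes "q \<noteq> 1"
  shows "\<omega> = (1 - q) * hahn_fix q \<omega>"
  using assms by (simp add: hahn_fix_def)

text \<open>Centring at the fixed point removes \<open>\<omega>\<close> and leaves plain scaling by
  \<open>q\<close>, so iterates become explicit powers.\<close>

lemma hahn_shift_eq:
  assumes "q \<noteq> 1"
  shows "hahn_shift q \<omega> t = hahn_fix q \<omega> + q * (t - hahn_fix q \<omega>)"
  unfolding hahn_shift_def by (subst hahn_fix_mult[OF assms]) (simp add: algebra_simps)

lemma hahn_unshift_eq:
  assumes "q \<noteq> 1" "q \<noteq> 0"
  shows "hahn_unshift q \<omega> t = hahn_fix q \<omega> + (t - hahn_fix q \<omega>) / q"
  unfolding hahn_unshift_def
  by (subst hahn_fix_mult[OF assms(1)]) (use assms(2) in \<open>simp add: field_simps\<close>)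

lemma hahn_shift_funpow:
  assumes "q \<noteq> 1"
  shows "(hahn_shift q \<omega> ^^ n) x = hahn_fix q \<omega> + q ^ n * (x - hahn_fix q \<omega>)"
  by (induction n) (simp_all add: hahn_shift_eq[OF assms])

text \<open>Inserting \<open>\<omega> = (1 - q) * hahn_fix q \<omega>\<close> makes the denominator
  a multiple of the distance to the fixed point, in the form needed for cancellation against the
  weights of the integral.\<close>

lemma hahn_deriv_eq:
  assumes "q \<noteq> 1" "q \<noteq> 0" "t \<noteq> hahn_fix q \<omega>"
  shows "hahn_deriv q \<omega> I f t =
    (f (hahn_shift q \<omega> t) - f (hahn_unshift q \<omega> t)) / ((q - inverse q) * (t - hahn_fix q \<omega>))"
proof -
  have "(q - inverse q) * t + (1 + inverse q) * \<omega> = (q - inverse q) * (t - hahn_fix q \<omega>)"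
    by (subst (1) hahn_fix_mult[OF assms(1)]) (use assms(2) in \<open>simp add: field_simps\<close>)
  then show ?thesis
    using assms(3) by (simp add: hahn_deriv_def)
qed

lemma hahn_shift_funpow_tendsto:
  assumes "0 < q" "q < 1"
  shows "(\<lambda>n. (hahn_shift q \<omega> ^^ n) x) \<longlonglongrightarrow> hahn_fix q \<omega>"
proof -
  have "(\<lambda>n. q ^ n) \<longlonglongrightarrow> 0"
    using LIMSEQ_power_zero[of q] assms by simp
  then have "(\<lambda>n. hahn_fix q \<omega> + q ^ n * (x - hahn_fix q \<omega>)) \<longlonglongrightarrow>
      hahn_fix q \<omega> + 0 * (x - hahn_fix q \<omega>)"
    by (intro tendsto_add tendsto_mult tendsto_const)
  then show ?thesis
    using assms by (simp add: hahn_shift_funpow)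
qed

text \<open>An iterate is a convex combination of \<open>x\<close> and the fixed point, with weights
  \<open>q ^ n\<close> and \<open>1 - q ^ n\<close>.\<close>

lemma hahn_shift_funpow_mem:
  assumes "0 < q" "q < 1" "is_interval I" "hahn_fix q \<omega> \<in> I" "x \<in> I"
  shows "(hahn_shift q \<omega> ^^ n) x \<in> I"
proof -
  have "(1 - q ^ n) *\<^sub>R hahn_fix q \<omega> + q ^ n *\<^sub>R x \<in> I"
    using assms by (intro convexD) (auto simp: is_interval_convex power_le_one)
  also have "(1 - q ^ n) *\<^sub>R hahn_fix q \<omega> + q ^ n *\<^sub>R x = (hahn_shift q \<omega> ^^ n) x"
    using assms by (simp add: hahn_shift_funpow algebra_simps)
  finally show ?thesis .
qed

text \<open>Stated for general \<open>S\<close> and \<open>k\<close> to serve two cases: integrands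
  along odd iterates, in the image of \<open>I\<close>, and primitives along even iterates, in
  \<open>I\<close>.\<close>

lemma tendsto_along_hahn_shift_funpow:
  assumes "0 < q" "q < 1" "continuous (at (hahn_fix q \<omega>) within S) f"
    and "\<And>n. (hahn_shift q \<omega> ^^ k n) x \<in> S" and "filterlim k sequentially sequentially"
  shows "(\<lambda>n. f ((hahn_shift q \<omega> ^^ k n) x)) \<longlonglongrightarrow> f (hahn_fix q \<omega>)"
proof -
  have "(\<lambda>n. (hahn_shift q \<omega> ^^ k n) x) \<longlonglongrightarrow> hahn_fix q \<omega>"
    using hahn_shift_funpow_tendsto[OF assms(1,2)] assms(5) by (rule filterlim_compose)
  then show ?thesis
    using assms(3,4) by (simp add: continuous_within_sequentially o_def)
qed

text \<open>Continuity at the fixed point makes the sampled values converge, hence bounded, so a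
  geometric series dominates.\<close>

lemma hahn_integral0_series_summable:
  assumes "0 < q" "q < 1" "is_interval I" "hahn_fix q \<omega> \<in> I" "x \<in> I"
    and cont: "continuous (at (hahn_fix q \<omega>) within (hahn_shift q \<omega> ` I)) f"
  shows "summable (\<lambda>n. q ^ (2 * n + 1) * f ((hahn_shift q \<omega> ^^ (2 * n + 1)) x))"
proof -
  have "(\<lambda>n. f ((hahn_shift q \<omega> ^^ (2 * n + 1)) x)) \<longlonglongrightarrow> f (hahn_fix q \<omega>)"
  proof (rule tendsto_along_hahn_shift_funpow[OF assms(1,2) cont])
    \<comment> \<open>An odd iterate is the shift of an even iterate, and the latter lies in
      \<open>I\<close>.\<close>
    show "(hahn_shift q \<omega> ^^ (2 * n + 1)) x \<in> hahn_shift q \<omega> ` I" for n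
      using hahn_shift_funpow_mem[OF assms(1-5)] by simp
    show "filterlim (\<lambda>n::nat. 2 * n + 1) sequentially sequentially"
      by (intro filterlim_subseq strict_monoI) simp
  qed
  then have "Bseq (\<lambda>n. f ((hahn_shift q \<omega> ^^ (2 * n + 1)) x))"
    by (intro convergent_imp_Bseq convergentI)
  then obtain K where K: "\<And>n. norm (f ((hahn_shift q \<omega> ^^ (2 * n + 1)) x)) \<le> K"
    by (metis BseqE)
  \<comment> \<open>Only odd powers of \<open>q\<close> occur as weights, so the ratio is
    \<open>q ^ 2\<close> with leading factor \<open>q\<close>.\<close>
  have "summable (\<lambda>n. K * q * (q ^ 2) ^ n)"
    using assms(1,2) by (intro summable_mult summable_geometric) (simp add: power_less_one_iff)
  then show ?thesis
  proof (rule summable_comparison_test')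
    show "norm (q ^ (2 * n + 1) * f ((hahn_shift q \<omega> ^^ (2 * n + 1)) x)) \<le> K * q * (q ^ 2) ^ n" for n
    proof -
      have "norm (q ^ (2 * n + 1) * f ((hahn_shift q \<omega> ^^ (2 * n + 1)) x)) \<le> q ^ (2 * n + 1) * K"
        using assms(1) mult_left_mono[OF K[of n], of "q ^ (2 * n + 1)"] by (simp add: abs_mult)
      then show ?thesis
        by (simp add: mult_ac flip: power_mult)
    qed
  qed
qed

lemma hahn_integral0_diff:
  assumes "0 < q" "q < 1" "is_interval I" "hahn_fix q \<omega> \<in> I" "x \<in> I"
    and "continuous (at (hahn_fix q \<omega>) within (hahn_shift q \<omega> ` I)) f"
    and "continuous (at (hahn_fix q \<omega>) within (hahn_shift q \<omega> ` I)) g"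
  shows "hahn_integral0 q \<omega> x f - hahn_integral0 q \<omega> x g = hahn_integral0 q \<omega> x (\<lambda>t. f t - g t)"
  using suminf_diff[OF hahn_integral0_series_summable[OF assms(1-5,6)]
      hahn_integral0_series_summable[OF assms(1-5,7)]]
  by (simp add: hahn_integral0_def right_diff_distrib flip: right_diff_distrib)

text \<open>The integral samples odd iterates only, so an identity known just on
  \<open>hahn_points\<close> can be integrated.\<close>

lemma hahn_integral0_cong:
  assumes "\<And>n. f ((hahn_shift q \<omega> ^^ (2 * n + 1)) x) = g ((hahn_shift q \<omega> ^^ (2 * n + 1)) x)"
  shows "hahn_integral0 q \<omega> x f = hahn_integral0 q \<omega> x g"
  unfolding hahn_integral0_def assms ..

text \<open>At the iterate of index \<open>2 * n + 1\<close> the derivative sees \<open>g\<close>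
  only at the neighbouring even iterates. The weight cancels its denominator up to the prefactor,
  and the series telescopes from \<open>x\<close> to the fixed point.\<close>

lemma hahn_integral0_deriv:
  assumes "0 < q" "q < 1" "is_interval I" "hahn_fix q \<omega> \<in> I" "x \<in> I"
    and cont: "continuous (at (hahn_fix q \<omega>) within I) g"
  shows "hahn_integral0 q \<omega> x (hahn_deriv q \<omega> I g) = g x - g (hahn_fix q \<omega>)"
proof (cases "x = hahn_fix q \<omega>")
  \<comment> \<open>Here the prefactor of the series vanishes, so the value of the derivative at the
    fixed point does not matter.\<close>
  case True
  then show ?thesis
    using assms(1,2) by (simp add: hahn_integral0_def hahn_shift_eq hahn_unshift_eq)
next
  case False
  define c where "c = hahn_unshift q \<omega> x - hahn_shift q \<omega> x"
  define w where "w n = (hahn_shift q \<omega> ^^ (2 * n)) x" for n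
  have c: "c = (inverse q - q) * (x - hahn_fix q \<omega>)"
    using assms(1,2) by (simp add: c_def hahn_shift_eq hahn_unshift_eq field_simps)
  have "inverse q > 1"
    using assms(1,2) by (simp add: one_less_inverse)
  then have "c \<noteq> 0"
    using False assms(2) by (simp add: c)
  have summand: "q ^ (2 * n + 1) * hahn_deriv q \<omega> I g ((hahn_shift q \<omega> ^^ (2 * n + 1)) x) =
      (g (w n) - g (w (Suc n))) / c" for n
  proof -
    let ?t = "(hahn_shift q \<omega> ^^ (2 * n + 1)) x"
    have t: "?t - hahn_fix q \<omega> = q ^ (2 * n + 1) * (x - hahn_fix q \<omega>)"
      using assms(2) by (simp only: hahn_shift_funpow)
    have "?t \<noteq> hahn_fix q \<omega>"
      using t False assms(1) by auto
    moreover have "hahn_shift q \<omega> ?t = w (Suc n)"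
      by (simp add: w_def)
    moreover have "hahn_unshift q \<omega> ?t = w n"
      using assms(1) by (simp add: w_def hahn_shift_def hahn_unshift_def)
    ultimately have "hahn_deriv q \<omega> I g ?t =
        (g (w (Suc n)) - g (w n)) / ((q - inverse q) * (q ^ (2 * n + 1) * (x - hahn_fix q \<omega>)))"
      using assms(1,2) t by (simp del: funpow.simps add: hahn_deriv_eq)
    \<comment> \<open>The derivative's denominator has the opposite sign to \<open>c\<close>; this
      turns the difference of \<open>g\<close> around into the order of
      \<open>summand\<close>.\<close>
    also have "(q - inverse q) * (q ^ (2 * n + 1) * (x - hahn_fix q \<omega>)) = - (q ^ (2 * n + 1) * c)"
      by (simp add: c algebra_simps)
    finally show ?thesis
      using assms(1) \<open>c \<noteq> 0\<close> by (simp add: field_simps)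
  qed
  have "(\<lambda>n. g (w n)) \<longlonglongrightarrow> g (hahn_fix q \<omega>)"
    unfolding w_def
  proof (rule tendsto_along_hahn_shift_funpow[OF assms(1,2) cont])
    show "(hahn_shift q \<omega> ^^ (2 * n)) x \<in> I" for n
      using hahn_shift_funpow_mem[OF assms(1-5)] .
    show "filterlim (\<lambda>n::nat. 2 * n) sequentially sequentially"
      by (intro filterlim_subseq strict_monoI) simp
  qed
  then have "(\<lambda>n. (g (w n) - g (w (Suc n))) / c) sums ((g (w 0) - g (hahn_fix q \<omega>)) / c)"
    by (intro sums_divide telescope_sums')
  then have "hahn_integral0 q \<omega> x (hahn_deriv q \<omega> I g) = c * ((g (w 0) - g (hahn_fix q \<omega>)) / c)"
    unfolding hahn_integral0_def c_def[symmetric] summand by (simp only: sums_iff)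
  then show ?thesis
    using \<open>c \<noteq> 0\<close> by (simp add: w_def)
qed

text \<open>Every competitor in \<open>B\<close> is the image of one in \<open>A\<close>, and adding
  the constant \<open>c\<close> preserves every comparison.\<close>

lemma is_arg_max_image:
  fixes f :: "'a \<Rightarrow> 'c::linordered_ab_group_add"
  assumes "h ` A = B" "\<And>x. x \<in> A \<Longrightarrow> g (h x) = f x + c"
    and "is_arg_max f (\<lambda>x. x \<in> A) x"
  shows "is_arg_max g (\<lambda>y. y \<in> B) (h x)"
  using assms by (auto simp: is_arg_max_def)

lemma is_arg_min_image:
  fixes f :: "'a \<Rightarrow> 'c::linordered_ab_group_add"
  assumes "h ` A = B" "\<And>x. x \<in> A \<Longrightarrow> g (h x) = f x + c"
    and "is_arg_min f (\<lambda>x. x \<in> A) x"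
  shows "is_arg_min g (\<lambda>y. y \<in> B) (h x)"
  using assms by (auto simp: is_arg_min_def)

theorem lemma7p3p12:
  fixes q \<omega> a b \<alpha> \<beta> :: real
    and I :: "real set"
    and L Lbar :: "real \<Rightarrow> real \<Rightarrow> real \<Rightarrow> real"
    and z zbar G :: "real \<Rightarrow> real \<Rightarrow> real"
    and ybar_star :: "real \<Rightarrow> real"
  assumes "0 < q" and "q < 1" and "0 \<le> \<omega>"
    and "is_interval I" and "hahn_fix q \<omega> \<in> I"
    and "a \<in> I" and "b \<in> I" and "a < b"
    and "hahn_lagrangian q \<omega> I a b \<alpha> \<beta> L"
    and "hahn_lagrangian q \<omega> I a b (zbar a \<alpha>) (zbar b \<beta>) Lbar"
    and "\<And>t u v. t \<in> hahn_points q \<omega> a b \<Longrightarrow> v = z t u \<longleftrightarrow> u = zbar t v"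
    and "bij_betw (hahn_transform I z)
           (hahn_admissible q \<omega> I a b (zbar a \<alpha>) (zbar b \<beta>))
           (hahn_admissible q \<omega> I a b \<alpha> \<beta>)"
    and "\<And>y ybar. ybar \<in> hahn_admissible q \<omega> I a b (zbar a \<alpha>) (zbar b \<beta>) \<Longrightarrow>
           y = hahn_transform I z ybar \<Longrightarrow>
           (\<lambda>\<tau>. G \<tau> (ybar \<tau>)) differentiable (at (hahn_fix q \<omega>) within I) \<and>
           (\<forall>t\<in>hahn_points q \<omega> a b.
              L t (y (hahn_shift q \<omega> t)) (hahn_deriv q \<omega> I y t)
              - Lbar t (ybar (hahn_shift q \<omega> t)) (hahn_deriv q \<omega> I ybar t)
              = hahn_deriv q \<omega> I (\<lambda>\<tau>. G \<tau> (ybar \<tau>)) t)"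
  shows "(is_arg_max (hahn_functional q \<omega> I a b Lbar)
            (\<lambda>ybar. ybar \<in> hahn_admissible q \<omega> I a b (zbar a \<alpha>) (zbar b \<beta>)) ybar_star \<longrightarrow>
          is_arg_max (hahn_functional q \<omega> I a b L)
            (\<lambda>y. y \<in> hahn_admissible q \<omega> I a b \<alpha> \<beta>) (hahn_transform I z ybar_star)) \<and>
         (is_arg_min (hahn_functional q \<omega> I a b Lbar)
            (\<lambda>ybar. ybar \<in> hahn_admissible q \<omega> I a b (zbar a \<alpha>) (zbar b \<beta>)) ybar_star \<longrightarrow>
          is_arg_min (hahn_functional q \<omega> I a b L)
            (\<lambda>y. y \<in> hahn_admissible q \<omega> I a b \<alpha> \<beta>) (hahn_transform I z ybar_star))"
proof -
  let ?Abar = "hahn_admissible q \<omega> I a b (zbar a \<alpha>) (zbar b \<beta>)"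
  let ?A = "hahn_admissible q \<omega> I a b \<alpha> \<beta>"
  have img: "hahn_transform I z ` ?Abar = ?A"
    using assms(12) by (rule bij_betw_imp_surj_on)
  have "hahn_functional q \<omega> I a b L (hahn_transform I z v) =
      hahn_functional q \<omega> I a b Lbar v + (G b (zbar b \<beta>) - G a (zbar a \<alpha>))"
    if v: "v \<in> ?Abar" for v
  proof -
    define y where "y = hahn_transform I z v"
    define g where "g = (\<lambda>\<tau>. G \<tau> (v \<tau>))"
    have "y \<in> ?A"
      using img v by (auto simp: y_def)
    then have cL: "continuous (at (hahn_fix q \<omega>) within (hahn_shift q \<omega> ` I)) (hahn_along q \<omega> I L y)"
      using assms(9) by (simp add: hahn_lagrangian_def)
    have cLbar: "continuous (at (hahn_fix q \<omega>) within (hahn_shift q \<omega> ` I)) (hahn_along q \<omega> I Lbar v)"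
      using assms(10) v by (simp add: hahn_lagrangian_def)
    \<comment> \<open>The assumed differentiability of \<open>G\<close> along \<open>v\<close>
      supplies the continuity that identifies the limit of the telescoping sum.\<close>
    have cg: "continuous (at (hahn_fix q \<omega>) within I) g"
      using assms(13)[OF v refl] by (simp add: g_def differentiable_imp_continuous_within)
    have along: "hahn_along q \<omega> I L y t - hahn_along q \<omega> I Lbar v t = hahn_deriv q \<omega> I g t"
      if "t \<in> hahn_points q \<omega> a b" for t
      using assms(13)[OF v y_def] that by (simp add: hahn_along_def g_def)
    have "hahn_integral0 q \<omega> x (hahn_along q \<omega> I L y) - hahn_integral0 q \<omega> x (hahn_along q \<omega> I Lbar v)
        = g x - g (hahn_fix q \<omega>)" if "x \<in> {a, b}" for x
    proof -
      have "x \<in> I"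
        using that assms(6,7) by auto
      have "(hahn_shift q \<omega> ^^ (2 * n + 1)) x \<in> hahn_points q \<omega> a b" for n
        using that unfolding hahn_points_def by blast
      then have "hahn_integral0 q \<omega> x (\<lambda>t. hahn_along q \<omega> I L y t - hahn_along q \<omega> I Lbar v t) =
          hahn_integral0 q \<omega> x (hahn_deriv q \<omega> I g)"
        by (intro hahn_integral0_cong along)
      then show ?thesis
        using hahn_integral0_diff[OF assms(1,2,4,5) \<open>x \<in> I\<close> cL cLbar]
          hahn_integral0_deriv[OF assms(1,2,4,5) \<open>x \<in> I\<close> cg] by simp
    qed
    \<comment> \<open>The contributions \<open>g (hahn_fix q \<omega>)\<close> from the two
      endpoints cancel.\<close>
    from this[of a] this[of b] have "hahn_functional q \<omega> I a b L y =
        hahn_functional q \<omega> I a b Lbar v + (g b - g a)"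
      by (simp add: hahn_functional_def hahn_integral_def)
    \<comment> \<open>Admissibility fixes \<open>v a\<close> and \<open>v b\<close>, which makes the
      difference independent of \<open>v\<close>.\<close>
    then show ?thesis
      using v by (simp add: y_def g_def hahn_admissible_def)
  qed
  note shift = this
  show ?thesis
    \<comment> \<open>Rotating the premises lets the extremality of \<open>ybar_star\<close> be
      consumed first, which determines the functional for \<open>Lbar\<close>; \<open>shift\<close>
      then supplies the constant.\<close>
    by (intro conjI impI)
      (erule is_arg_max_image[OF img, rotated] is_arg_min_image[OF img, rotated], erule shift)+
qed

end
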